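(* Let $3\le r\le 8$. For a ruling $f$ and a line $l$ in $Pic\,S_r$, the following are equivalent. (1) $f\cdot l=0$. (2) $f-l$ is a line. (3) The vertex represented by $l$ in the Gosset polytope $(r-4)_{21}$ is one of the vertices of the $(r-1)$-crosspolytope corresponding to $f$.
   Context: $S_r$ is a del Pezzo surface obtained by blowing up $\mathbb{P}^2$ at $r$ points in general position. $Pic\,S_r=\mathbb{Z}h\oplus\mathbb{Z}e_1\oplus\dots\oplus\mathbb{Z}e_r$ with $h^2=1$, $h\cdot e_i=0$, $e_i\cdot e_j=-\delta_{ij}$, and $K_{S_r}=-3h+\sum_{i=1}^r e_i$. A line is a class $l\in Pic\,S_r$ with $l^2=l\cdot K_{S_r}=-1$; $L_r$ is the set of lines. A ruling is a class $f\in Pic\,S_r$ with $f^2=0$, $K_{S_r}\cdot f=-2$. The Gosset polytope $(r-4)_{21}$ is the $r$-dimensional semiregular polytope with symmetry group the Coxeter group $E_r$ ($E_3=A_1\times A_2$, $E_4=A_4$, $E_5=D_5$), realized as the convex hull of $L_r$ in $\{D\in Pic\,S_r\otimes\mathbb{Q}\mid -D\cdot K_{S_r}=1\}$ with the Euclidean metric given by minus the intersection form; its vertices are exactly the elements of $L_r$. Its facets are regular $(r-1)$-simplexes and $(r-1)$-crosspolytopes (a $2$-crosspolytope is a square). The center of an $(r-1)$-crosspolytope in $(r-4)_{21}$ is taken to be the sum $l_1+l_2\in Pic\,S_r$ of any pair of antipodal vertices; sending a crosspolytope to its center is a bijection between the $(r-1)$-crosspolytopes of $(r-4)_{21}$ and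 the rulings, and the crosspolytope corresponding to $f$ is the one with center $f$. *)

theory Defs
  imports "HOL-Analysis.Analysis"
begin

section \<open>The Picard lattice of a blow-up of the plane\<close>

text \<open>
  The class \<open>d h + a\<^sub>1 e\<^sub>1 + \<dots> + a\<^sub>r e\<^sub>r\<close> is the pair \<open>(d, a)\<close>. The exceptional classes are
  indexed by a finite type \<open>'r\<close>, so that \<open>r = CARD('r)\<close>. The same
  coordinates are used for \<open>Pic\<close> itself and for its real extension.
\<close>

type_synonym 'r pic = "int \<times> (int, 'r) vec"
type_synonym 'r pic_real = "real \<times> (real, 'r) vec"

definition intersection :: "'a::comm_ring_1 \<times> ('a, 'r::finite) vec \<Rightarrow> 'a \<times> ('a, 'r) vec \<Rightarrow> 'a"
    (infixl \<open>\<cdot>\<close> 70)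
  where "D \<cdot> E = fst D * fst E - (\<Sum>i\<in>UNIV. snd D $ i * snd E $ i)"

definition hyp :: "'a::comm_ring_1 \<times> ('a, 'r::finite) vec"
  where "hyp = (1, 0)"

definition exc :: "'r::finite \<Rightarrow> 'a::comm_ring_1 \<times> ('a, 'r) vec"
  where "exc i = (0, axis i 1)"

definition canonical :: "'a::comm_ring_1 \<times> ('a, 'r::finite) vec"
  where "canonical = - (hyp + hyp + hyp) + (\<Sum>i\<in>UNIV. exc i)"

lemma intersection_basis:
  "hyp \<cdot> hyp = (1 :: 'a::comm_ring_1)"
  "hyp \<cdot> exc i = (0 :: 'a)"
  "exc i \<cdot> exc j = (if i = j then - 1 else (0 :: 'a))"
  by (simp_all add: intersection_def hyp_def exc_def axis_def mult_delta_left)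

lemma canonical_eq: "(canonical :: 'a::comm_ring_1 \<times> ('a, 'r::finite) vec) = (- 3, \<chi> i. 1)"
proof -
  have "fst (\<Sum>i\<in>UNIV. exc i :: 'a \<times> ('a, 'r) vec) = 0"
    by (simp add: fst_sum exc_def)
  moreover have "snd (\<Sum>i\<in>UNIV. exc i :: 'a \<times> ('a, 'r) vec) = (\<chi> i. 1)"
    by (simp add: snd_sum exc_def vec_eq_iff axis_def)
  ultimately show ?thesis
    by (simp add: canonical_def hyp_def prod_eq_iff)
qed

definition line :: "'r::finite pic \<Rightarrow> bool"
  where "line l \<longleftrightarrow> l \<cdot> l = - 1 \<and> l \<cdot> canonical = - 1"

definition ruling :: "'r::finite pic \<Rightarrow> bool"
  where "ruling f \<longleftrightarrow> f \<cdot> f = 0 \<and> canonical \<cdot> f = - 2"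

definition real_class :: "'r::finite pic \<Rightarrow> 'r pic_real"
  where "real_class D = (of_int (fst D), \<chi> i. of_int (snd D $ i))"

lemma real_class_intersection: "real_class D \<cdot> real_class E = of_int (D \<cdot> E)"
  by (simp add: intersection_def real_class_def)

lemma real_class_canonical: "real_class canonical = canonical"
  by (simp add: real_class_def canonical_eq vec_eq_iff)

section \<open>The Gosset polytope and its crosspolytopes\<close>

definition gosset :: "'r::finite pic_real set"
  where "gosset = convex hull (real_class ` {l. line l})"

lemma gosset_subset_hyperplane: "gosset \<subseteq> {D :: 'r::finite pic_real. - (D \<cdot> canonical) = 1}"
  unfolding gosset_def
proof (rule hull_minimal)
  show "real_class ` {l :: 'r pic. line l} \<subseteq> {D. - (D \<cdot> canonical) = 1}"
    by (auto simp: line_def real_class_intersection simp flip: real_class_canonical)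
  show "convex {D :: 'r pic_real. - (D \<cdot> canonical) = 1}"
  proof (rule convexI, clarify)
    fix a b and u v :: real
    fix x y :: "real^'r"
    assume *: "- ((a, x) \<cdot> canonical) = 1" "- ((b, y) \<cdot> canonical) = 1" "u + v = 1"
    have "- ((u *\<^sub>R (a, x) + v *\<^sub>R (b, y)) \<cdot> canonical) = u * - ((a, x) \<cdot> canonical) + v * - ((b, y) \<cdot> canonical)"
      by (simp add: intersection_def canonical_eq algebra_simps sum.distrib sum_distrib_left)
    then show "- ((u *\<^sub>R (a, x) + v *\<^sub>R (b, y)) \<cdot> canonical) = 1"
      using * by simp
  qed
qed

text \<open>
  A regular \<open>k\<close>-crosspolytope, for the metric given by minus the intersection form, is the hull of
  the points \<open>c \<plusminus> v\<^sub>i\<close> (\<open>i < k\<close>) with the \<open>v\<^sub>i\<close> pairwise orthogonal and of equal positive length.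
  Minus the intersection form is indefinite on the whole space, but for \<open>r \<le> 8\<close> it is positive
  definite on the directions of the hyperplane \<open>- (D \<cdot> canonical) = 1\<close>; the notions below are used
  only for subsets of it.
\<close>

definition crosspolytope_frame ::
    "nat \<Rightarrow> 'r::finite pic_real set \<Rightarrow> 'r pic_real \<Rightarrow> (nat \<Rightarrow> 'r pic_real) \<Rightarrow> bool"
  where "crosspolytope_frame k P c v \<longleftrightarrow>
    (\<exists>\<rho>>0. \<forall>i<k. \<forall>j<k. - (v i \<cdot> v j) = (if i = j then \<rho> else 0)) \<and>
    P = convex hull (\<Union>i<k. {c + v i, c - v i})"

definition regular_crosspolytope :: "nat \<Rightarrow> 'r::finite pic_real set \<Rightarrow> bool"
  where "regular_crosspolytope k P \<longleftrightarrow> (\<exists>c v. crosspolytope_frame k P c v)"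

definition antipodal :: "nat \<Rightarrow> 'r::finite pic_real set \<Rightarrow> 'r pic_real \<Rightarrow> 'r pic_real \<Rightarrow> bool"
  where "antipodal k P x y \<longleftrightarrow>
    (\<exists>c v i. crosspolytope_frame k P c v \<and> i < k \<and> x = c + v i \<and> y = c - v i)"

text \<open>The center is the sum, not the midpoint, of a pair of antipodal vertices.\<close>

definition center :: "nat \<Rightarrow> 'r::finite pic_real set \<Rightarrow> 'r pic_real"
  where "center k P = (THE D. \<exists>x y. antipodal k P x y \<and> D = x + y)"

definition gosset_crosspolytope :: "'r::finite pic_real set \<Rightarrow> bool"
  where "gosset_crosspolytope P \<longleftrightarrow>
    P facet_of gosset \<and> regular_crosspolytope (CARD('r) - 1) P"

definition crosspolytope_of :: "'r::finite pic \<Rightarrow> 'r pic_real set"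
  where "crosspolytope_of f =
    (THE P. gosset_crosspolytope P \<and> center (CARD('r) - 1) P = real_class f)"

end

theory Submission
  imports Defs
begin

text \<open>
  The equivalence of \<open>f \<cdot> l = 0\<close> with \<open>f - l\<close> being a line is bilinearity:
  \<open>(f - l) \<cdot> canonical = - 1\<close> always, and \<open>(f - l) \<cdot> (f - l) = - 1 - 2 (f \<cdot> l)\<close>.

  For the polytope, the key is that the form is negative definite on the orthogonal complement of the
  canonical class, by Cauchy-Schwarz and \<open>r < 9\<close>. Applied to \<open>l - l'\<close> and to \<open>f - 2 l\<close>,
  it says that \<open>l \<cdot> _\<close> attains its minimum over the lines only at \<open>l\<close>, so that every line
  is a vertex of the Gosset polytope, and that \<open>f \<cdot> _\<close> is nonnegative on the lines. Hence
  \<open>f \<cdot> x = 0\<close> cuts out a face of the polytope (\<open>ruling_face\<close>), and the lines among its vertices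
  are those with \<open>f \<cdot> l = 0\<close>. What is left is that this face is \<open>crosspolytope_of f\<close>.

  The face is a crosspolytope because the conic bundle \<open>f\<close> has exactly \<open>r - 1\<close> singular fibres
  \<open>L\<^sub>i + (f - L\<^sub>i)\<close>, with the \<open>L\<^sub>i\<close> pairwise orthogonal, and their components are all the
  lines orthogonal to \<open>f\<close> (\<open>ruling_singular_fibres\<close>): with respect to the centre
  \<open>f / 2\<close> the vertices are \<open>f / 2 \<plusminus> (L\<^sub>i - f / 2)\<close>, and \<open>f \<cdot> f = f \<cdot> L\<^sub>i = 0\<close> makes
  the vectors \<open>L\<^sub>i - f / 2\<close> orthonormal up to sign. The fibres are explicit for
  \<open>f = h - e\<^sub>k\<close>, and Noether's inequality yields quadratic Cremona transformations that lower the
  degree of any other ruling until it has this form. A crosspolytope with \<open>r - 1\<close> axes has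
  dimension at least \<open>r - 1\<close>, so the face, being proper, is a facet.

  It is the only facet that is a crosspolytope with center \<open>f\<close>: a face that is symmetric about a
  point lies in every face that contains this point (\<open>symmetric_face_subset\<close>), so two
  symmetric faces with the same centre coincide.
\<close>

section \<open>The intersection form\<close>

lemma intersection_commute: "D \<cdot> E = E \<cdot> D"
  by (simp add: intersection_def mult.commute)

lemma intersection_add_left: "(D + E) \<cdot> F = D \<cdot> F + E \<cdot> F"
  by (simp add: intersection_def algebra_simps sum.distrib)

lemma intersection_diff_left: "(D - E) \<cdot> F = D \<cdot> F - E \<cdot> F"
  by (simp add: intersection_def algebra_simps sum_subtractf)

lemma intersection_add_right: "F \<cdot> (D + E) = F \<cdot> D + F \<cdot> E"
  by (simp add: intersection_def algebra_simps sum.distrib)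

lemma intersection_diff_right: "F \<cdot> (D - E) = F \<cdot> D - F \<cdot> E"
  by (simp add: intersection_def algebra_simps sum_subtractf)

lemmas intersection_bilinear =
  intersection_add_left intersection_diff_left intersection_add_right intersection_diff_right

text \<open>
  This turns sets such as \<open>{x. D \<cdot> x = b}\<close> into Euclidean hyperplanes, so that the theory of
  supporting hyperplanes and affine dimension applies to them.
\<close>

lemma intersection_eq_inner: "D \<cdot> x = (fst D, - snd D) \<bullet> x" for D :: "'r::finite pic_real"
  by (simp add: intersection_def inner_prod_def inner_vec_def sum_negf)

lemma real_class_diff: "real_class (D - E) = real_class D - real_class E"
  by (simp add: real_class_def vec_eq_iff)

lemma intersection_canonical:
  "D \<cdot> canonical = - 3 * fst D - (\<Sum>i\<in>UNIV. snd D $ i)" for D :: "'r::finite pic"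
  by (simp add: intersection_def canonical_eq)

lemma intersection_self: "D \<cdot> D = (fst D)\<^sup>2 - (\<Sum>i\<in>UNIV. (snd D $ i)\<^sup>2)" for D :: "'r::finite pic"
  by (simp add: intersection_def power2_eq_square)

lemma line_exc: "line (exc i :: 'r::finite pic)"
  by (simp add: line_def intersection_canonical intersection_self)
     (simp add: exc_def axis_def if_distrib[of "\<lambda>x. x ^ 2"] cong: if_cong)

lemma intersection_exc: "D \<cdot> exc i = - snd D $ i" for D :: "'r::finite pic"
  by (simp add: intersection_def exc_def axis_def mult_delta_right)

lemma sum_squared_le_int:
  fixes a :: "'r::finite \<Rightarrow> int"
  shows "(\<Sum>i\<in>UNIV. a i)\<^sup>2 \<le> int CARD('r) * (\<Sum>i\<in>UNIV. (a i)\<^sup>2)"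
proof -
  have "real_of_int ((\<Sum>i\<in>UNIV. a i)\<^sup>2) \<le> real_of_int (int CARD('r) * (\<Sum>i\<in>UNIV. (a i)\<^sup>2))"
    using sum_squared_le_sum_of_squares[of "\<lambda>i. real_of_int (a i)" UNIV] by (simp add: mult.commute)
  then show ?thesis
    by (simp only: of_int_le_iff)
qed

text \<open>
  For a class \<open>(d, a)\<close> orthogonal to the canonical class, \<open>- 3 d\<close> is the sum of the \<open>a\<^sub>i\<close>, so
  Cauchy-Schwarz bounds \<open>9 d\<^sup>2\<close> by \<open>r\<close> times the sum of their squares. The condition
  \<open>r \<le> 8\<close> leaves a negative multiple of that sum; both semidefiniteness and definiteness follow.
\<close>

lemma nine_times_self_intersection:
  fixes D :: "'r::finite pic"
  assumes "CARD('r) \<le> 8" and "D \<cdot> canonical = 0"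
  shows "9 * (D \<cdot> D) \<le> - (\<Sum>i\<in>UNIV. (snd D $ i)\<^sup>2)"
proof -
  let ?q = "\<Sum>i\<in>UNIV. (snd D $ i)\<^sup>2"
  have "9 * (fst D)\<^sup>2 = (\<Sum>i\<in>UNIV. snd D $ i)\<^sup>2"
  proof -
    have "(\<Sum>i\<in>UNIV. snd D $ i) = - 3 * fst D"
      using assms(2) by (simp add: intersection_canonical)
    then show ?thesis by (simp add: power_mult_distrib)
  qed
  also have "\<dots> \<le> int CARD('r) * ?q"
    by (rule sum_squared_le_int)
  also have "\<dots> \<le> 8 * ?q"
    using assms(1) by (intro mult_right_mono) (auto intro: sum_nonneg)
  finally show ?thesis by (simp add: intersection_self)
qed

lemma canonical_orthogonal_nonpos:
  fixes D :: "'r::finite pic"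
  assumes "CARD('r) \<le> 8" and "D \<cdot> canonical = 0"
  shows "D \<cdot> D \<le> 0"
proof -
  have "0 \<le> (\<Sum>i\<in>UNIV. (snd D $ i)\<^sup>2)" by (auto intro: sum_nonneg)
  then show ?thesis using nine_times_self_intersection[OF assms] by linarith
qed

lemma canonical_orthogonal_definite:
  fixes D :: "'r::finite pic"
  assumes "CARD('r) \<le> 8" and "D \<cdot> canonical = 0" and "D \<cdot> D = 0"
  shows "D = 0"
proof -
  have "(\<Sum>i\<in>UNIV. (snd D $ i)\<^sup>2) = 0"
    using nine_times_self_intersection[OF assms(1,2)] assms(3)
      sum_nonneg[of UNIV "\<lambda>i. (snd D $ i)\<^sup>2"] by fastforce
  then have "snd D $ i = 0" for i
    by (simp add: sum_nonneg_eq_0_iff)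
  moreover from this have "fst D = 0"
    using assms(3) by (simp add: intersection_self)
  ultimately show ?thesis
    by (simp add: prod_eq_iff vec_eq_iff)
qed

lemma line_self: "line l \<Longrightarrow> l \<cdot> l = - 1"
  and line_canonical: "line l \<Longrightarrow> l \<cdot> canonical = - 1"
  by (simp_all add: line_def)

lemma ruling_self: "ruling f \<Longrightarrow> f \<cdot> f = 0"
  and ruling_canonical: "ruling f \<Longrightarrow> f \<cdot> canonical = - 2"
  by (simp_all add: ruling_def intersection_commute)

lemma line_diff_iff:
  assumes "ruling f" and "line l"
  shows "line (f - l) \<longleftrightarrow> f \<cdot> l = 0"
  using assms intersection_commute[of l f]
  by (auto simp: line_def ruling_self ruling_canonical intersection_bilinear)

text \<open>
  The class \<open>l - l'\<close> is orthogonal to the canonical class and has self-intersection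
  \<open>- 2 - 2 (l \<cdot> l')\<close>, so this is negative definiteness.
\<close>

lemma line_intersection_line:
  fixes l l' :: "'r::finite pic"
  assumes "CARD('r) \<le> 8" and "line l" and "line l'"
  shows "- 1 \<le> l \<cdot> l'" and "l \<cdot> l' = - 1 \<longleftrightarrow> l = l'"
proof -
  have K: "(l - l') \<cdot> canonical = 0"
    using assms by (simp add: intersection_bilinear line_canonical)
  have sq: "(l - l') \<cdot> (l - l') = - 2 - 2 * (l \<cdot> l')"
    using assms intersection_commute[of l' l] by (simp add: intersection_bilinear line_self)
  show "- 1 \<le> l \<cdot> l'"
    using canonical_orthogonal_nonpos[OF assms(1) K] sq by simp
  show "l \<cdot> l' = - 1 \<longleftrightarrow> l = l'"
  proof
    assume "l \<cdot> l' = - 1"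
    then show "l = l'"
      using canonical_orthogonal_definite[OF assms(1) K] sq by simp
  qed (use line_self[OF assms(3)] in simp)
qed

text \<open>
  The class \<open>f - 2 l\<close> is orthogonal to the canonical class and has self-intersection
  \<open>- 4 (f \<cdot> l) - 4\<close>. Semidefiniteness leaves only the case \<open>f \<cdot> l = - 1\<close>, which by definiteness
  would force \<open>f = 2 l\<close>, against \<open>f \<cdot> f = 0\<close>.
\<close>

lemma ruling_nef:
  fixes f l :: "'r::finite pic"
  assumes "CARD('r) \<le> 8" and "ruling f" and "line l"
  shows "0 \<le> f \<cdot> l"
proof (rule ccontr)
  assume neg: "\<not> 0 \<le> f \<cdot> l"
  let ?D = "f - l - l"
  have K: "?D \<cdot> canonical = 0"
    using assms by (simp add: intersection_bilinear line_canonical ruling_canonical)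
  have sq: "?D \<cdot> ?D = - 4 * (f \<cdot> l) - 4"
    using assms intersection_commute[of l f]
    by (simp add: intersection_bilinear line_self ruling_self)
  have "?D \<cdot> ?D = 0"
    using canonical_orthogonal_nonpos[OF assms(1) K] sq neg by linarith
  then have "f = l + l"
    using canonical_orthogonal_definite[OF assms(1) K] by (simp add: algebra_simps)
  then have "f \<cdot> f = - 4"
    using assms(3) by (simp add: intersection_bilinear line_self)
  then show False
    using ruling_self[OF assms(2)] by simp
qed

lemma ruling_sums:
  fixes f :: "'r::finite pic"
  assumes "ruling f"
  shows "(\<Sum>i\<in>UNIV. (snd f $ i)\<^sup>2) = (fst f)\<^sup>2"
    and "(\<Sum>i\<in>UNIV. snd f $ i) = 2 - 3 * fst f"
  using ruling_self[OF assms] ruling_canonical[OF assms]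
  by (simp_all add: intersection_self intersection_canonical)

text \<open>
  With \<open>d\<close> the degree of \<open>f\<close>, Cauchy-Schwarz gives \<open>(2 - 3 d)\<^sup>2 \<le> 8 d\<^sup>2\<close>, that is,
  \<open>d\<^sup>2 + 4 \<le> 12 d\<close>.
\<close>

lemma ruling_degree_pos:
  fixes f :: "'r::finite pic"
  assumes "CARD('r) \<le> 8" and "ruling f"
  shows "0 < fst f"
proof (rule ccontr)
  assume "\<not> 0 < fst f"
  then have d: "fst f \<le> 0" by simp
  have "(2 - 3 * fst f)\<^sup>2 \<le> int CARD('r) * (fst f)\<^sup>2"
    using sum_squared_le_int[of "\<lambda>i. snd f $ i"] by (simp add: ruling_sums[OF assms(2)])
  also have "\<dots> \<le> 8 * (fst f)\<^sup>2"
    using assms(1) by (intro mult_right_mono) auto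
  finally have "(fst f)\<^sup>2 + 4 \<le> 12 * fst f"
    by (simp add: power2_eq_square algebra_simps)
  moreover have "0 \<le> (fst f)\<^sup>2" by simp
  ultimately show False using d by linarith
qed

section \<open>Cremona descent for rulings\<close>

text \<open>
  Let \<open>x \<ge> y \<ge> z\<close> be the three largest multiplicities. In the sum of the \<open>m\<^sub>t (m\<^sub>t - z)\<close> only
  the terms of \<open>x\<close> and \<open>y\<close> can be positive, while the two hypotheses on \<open>m\<close> evaluate the sum to
  \<open>d (d - 3 z) + 2 z\<close>. If \<open>x + y + z \<le> d\<close>, the two positive terms add up to at most
  \<open>x (d - 3 z)\<close>, hence \<open>(d - x) (d - 3 z) + 2 z \<le> 0\<close>. This forces \<open>z = 0\<close> and \<open>x = d\<close>, so that
  \<open>x\<close> is the only nonzero multiplicity and the sum \<open>3 d - 2\<close> is \<open>d\<close>, against \<open>d \<ge> 2\<close>.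
\<close>

lemma noether_inequality:
  fixes m :: "'r::finite \<Rightarrow> int" and d :: int
  assumes "3 \<le> CARD('r)" and "2 \<le> d" and nonneg: "\<And>i. 0 \<le> m i"
    and sq: "(\<Sum>i\<in>UNIV. (m i)\<^sup>2) = d\<^sup>2" and lin: "(\<Sum>i\<in>UNIV. m i) = 3 * d - 2"
  obtains i j k where "i \<noteq> j" "i \<noteq> k" "j \<noteq> k" "d < m i + m j + m k"
proof -
  have maximal: "\<exists>i\<in>A. \<forall>j\<in>A. m j \<le> m i" if "A \<noteq> {}" for A :: "'r set"
  proof -
    have "Max (m ` A) \<in> m ` A"
      using that by (intro Max_in) auto
    then obtain i where i: "i \<in> A" "m i = Max (m ` A)" by auto
    then have "m j \<le> m i" if "j \<in> A" for j
      using that by simp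
    then show ?thesis using i(1) by blast
  qed
  obtain i where i: "\<And>x. m x \<le> m i"
    using maximal[of UNIV] by auto
  have "UNIV - {i} \<noteq> {}"
    using assms(1) card_mono[of "{i}" UNIV] by auto
  then obtain j where j: "j \<noteq> i" "\<And>x. x \<noteq> i \<Longrightarrow> m x \<le> m j"
    using maximal[of "UNIV - {i}"] by auto
  have "UNIV - {i, j} \<noteq> {}"
    using assms(1) card_mono[of "{i, j}" UNIV] j(1) by auto
  then obtain k where k: "k \<noteq> i" "k \<noteq> j" "\<And>x. x \<noteq> i \<Longrightarrow> x \<noteq> j \<Longrightarrow> m x \<le> m k"
    using maximal[of "UNIV - {i, j}"] by auto
  have split: "(\<Sum>x\<in>UNIV. g x) = g i + g j + g k + (\<Sum>x\<in>UNIV - {i, j, k}. g x)"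
    for g :: "'r \<Rightarrow> int"
    using j(1) k(1,2) sum.subset_diff[of "{i, j, k}" UNIV g] by simp
  have "d < m i + m j + m k"
  proof (rule ccontr)
    assume "\<not> d < m i + m j + m k"
    then have small: "m i + m j + m k \<le> d" by simp
    let ?x = "m i" and ?y = "m j" and ?z = "m k"
    have ord: "?y \<le> ?x" "?z \<le> ?y" "0 \<le> ?z"
      using i j(1) j(2)[of k] k nonneg by auto
    have "d\<^sup>2 - ?z * (3 * d - 2) = (\<Sum>x\<in>UNIV. m x * (m x - ?z))"
      unfolding sq[symmetric] lin[symmetric]
      by (simp add: sum_distrib_left algebra_simps sum_subtractf power2_eq_square)
    also have "\<dots> \<le> ?x * (?x - ?z) + ?y * (?y - ?z)"
      using k(3) nonneg by (simp add: split) (auto intro!: sum_nonpos mult_nonneg_nonpos)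
    also have "\<dots> \<le> ?x * (?x - ?z) + ?x * (?y - ?z)"
      using ord by (simp add: mult_right_mono)
    also have "\<dots> = ?x * (?x + ?y - 2 * ?z)"
      by (simp add: algebra_simps)
    also have "\<dots> \<le> ?x * (d - 3 * ?z)"
      using small nonneg by (intro mult_left_mono) auto
    finally have main: "(d - ?x) * (d - 3 * ?z) + 2 * ?z \<le> 0"
      by (simp add: algebra_simps power2_eq_square)
    have "0 \<le> (d - ?x) * (d - 3 * ?z)"
      using small ord by (intro mult_nonneg_nonneg) auto
    then have "?z = 0" "(d - ?x) * (d - 3 * ?z) = 0"
      using main ord by linarith+
    then have "?z = 0" "?x = d" "?y = 0"
      using small ord assms(2) by auto
    moreover have "(\<Sum>x\<in>UNIV - {i, j, k}. m x) \<le> 0"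
      using k(3) \<open>?z = 0\<close> by (intro sum_nonpos) auto
    ultimately show False
      using lin assms(2) split[of m] by linarith
  qed
  then show thesis using that[of i j k] j(1) k(1,2) by simp
qed

text \<open>
  The plus sign and the missing factor \<open>2 / (\<alpha> \<cdot> \<alpha>)\<close> are right for roots, that is, for
  \<open>\<alpha> \<cdot> \<alpha> = - 2\<close>. The Cremona transformation based at three of the points acts on the Picard
  lattice as the reflection in \<open>h - e\<^sub>i - e\<^sub>j - e\<^sub>k\<close>.
\<close>

definition reflection :: "'r::finite pic \<Rightarrow> 'r pic \<Rightarrow> 'r pic"
  where "reflection \<alpha> D = (fst D + (D \<cdot> \<alpha>) * fst \<alpha>, snd D + (D \<cdot> \<alpha>) *s snd \<alpha>)"

lemma intersection_reflection_left: "reflection \<alpha> D \<cdot> E = D \<cdot> E + (D \<cdot> \<alpha>) * (\<alpha> \<cdot> E)"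
proof -
  have "(fst D + c * fst \<alpha>, snd D + c *s snd \<alpha>) \<cdot> E = D \<cdot> E + c * (\<alpha> \<cdot> E)" for c
    by (simp add: intersection_def algebra_simps sum.distrib sum_distrib_left)
  then show ?thesis by (simp add: reflection_def)
qed

lemma intersection_reflection_right: "E \<cdot> reflection \<alpha> D = E \<cdot> D + (D \<cdot> \<alpha>) * (E \<cdot> \<alpha>)"
  using intersection_reflection_left[of \<alpha> D E] by (simp add: intersection_commute)

lemma reflection_isometry:
  "\<alpha> \<cdot> \<alpha> = - 2 \<Longrightarrow> reflection \<alpha> D \<cdot> reflection \<alpha> E = D \<cdot> E"
  by (simp add: intersection_reflection_left intersection_reflection_right
      intersection_commute[of \<alpha> E])

lemma reflection_involution: "\<alpha> \<cdot> \<alpha> = - 2 \<Longrightarrow> reflection \<alpha> (reflection \<alpha> D) = D"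
  unfolding reflection_def[of \<alpha> "reflection \<alpha> D"] intersection_reflection_left
  by (simp add: reflection_def vec_eq_iff prod_eq_iff)

lemma reflection_diff: "reflection \<alpha> (D - E) = reflection \<alpha> D - reflection \<alpha> E"
  by (simp add: reflection_def intersection_diff_left vec_eq_iff algebra_simps)

lemma reflection_canonical:
  "\<alpha> \<cdot> canonical = 0 \<Longrightarrow> reflection \<alpha> D \<cdot> canonical = D \<cdot> canonical"
  by (simp add: intersection_reflection_left)

lemma line_reflection:
  "\<alpha> \<cdot> \<alpha> = - 2 \<Longrightarrow> \<alpha> \<cdot> canonical = 0 \<Longrightarrow> line (reflection \<alpha> l) \<longleftrightarrow> line l"
  by (simp add: line_def reflection_isometry reflection_canonical)

lemma ruling_reflection:
  "\<alpha> \<cdot> \<alpha> = - 2 \<Longrightarrow> \<alpha> \<cdot> canonical = 0 \<Longrightarrow> ruling (reflection \<alpha> f) \<longleftrightarrow> ruling f"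
  by (simp add: ruling_def reflection_isometry reflection_canonical intersection_commute[of canonical])

text \<open>
  The singular fibres of the conic bundle \<open>f\<close> are pairs of lines \<open>L i\<close>, \<open>f - L i\<close> meeting in a
  point; \<open>L\<close> picks one component of each. The last clause says that every line contained in a fibre
  is one of these components.
\<close>

definition singular_fibres :: "'r::finite pic \<Rightarrow> (nat \<Rightarrow> 'r pic) \<Rightarrow> bool"
  where "singular_fibres f L \<longleftrightarrow>
    (\<forall>i < CARD('r) - 1. line (L i) \<and> f \<cdot> L i = 0) \<and>
    (\<forall>i < CARD('r) - 1. \<forall>j < CARD('r) - 1. i \<noteq> j \<longrightarrow> L i \<cdot> L j = 0) \<and>
    (\<forall>l. line l \<and> f \<cdot> l = 0 \<longrightarrow> (\<exists>i < CARD('r) - 1. l = L i \<or> l = f - L i))"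

lemma singular_fibres_reflection:
  assumes \<alpha>: "\<alpha> \<cdot> \<alpha> = - 2" "\<alpha> \<cdot> canonical = 0"
    and L: "singular_fibres (reflection \<alpha> f) L"
  shows "singular_fibres f (reflection \<alpha> \<circ> L)"
proof -
  let ?s = "reflection \<alpha>"
  have swap: "D \<cdot> ?s E = ?s D \<cdot> E" for D E
    using reflection_isometry[OF \<alpha>(1), of "D" "?s E"] reflection_involution[OF \<alpha>(1)] by simp
  have "\<exists>i < CARD('a) - 1. l = ?s (L i) \<or> l = f - ?s (L i)" if "line l" "f \<cdot> l = 0" for l
  proof -
    have "line (?s l)" "?s f \<cdot> ?s l = 0"
      using that by (simp_all add: line_reflection \<alpha> reflection_isometry)
    then obtain i where i: "i < CARD('a) - 1" "?s l = L i \<or> ?s l = ?s f - L i"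
      using L unfolding singular_fibres_def by blast
    then have "?s (?s l) = ?s (L i) \<or> ?s (?s l) = ?s (?s f) - ?s (L i)"
      by (auto simp: reflection_diff)
    then show ?thesis
      using i(1) by (auto simp: reflection_involution \<alpha>)
  qed
  moreover have "line (?s (L i)) \<and> f \<cdot> ?s (L i) = 0" if "i < CARD('a) - 1" for i
    using L that by (simp add: singular_fibres_def line_reflection \<alpha> swap)
  moreover have "?s (L i) \<cdot> ?s (L j) = 0"
    if "i < CARD('a) - 1" "j < CARD('a) - 1" "i \<noteq> j" for i j
    using L that by (simp add: singular_fibres_def \<alpha> reflection_isometry)
  ultimately show ?thesis
    unfolding singular_fibres_def o_apply by blast
qed

lemma sum_squares_eq_one:
  fixes a :: "'a \<Rightarrow> int"
  assumes "finite A" and "(\<Sum>i\<in>A. (a i)\<^sup>2) = 1"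
  obtains k where "k \<in> A" "a k = 1 \<or> a k = - 1" "\<And>i. i \<in> A \<Longrightarrow> i \<noteq> k \<Longrightarrow> a i = 0"
proof -
  have "\<exists>k\<in>A. a k \<noteq> 0"
  proof (rule ccontr)
    assume "\<not> (\<exists>k\<in>A. a k \<noteq> 0)"
    then have "(\<Sum>i\<in>A. (a i)\<^sup>2) = 0" by simp
    then show False using assms(2) by simp
  qed
  then obtain k where k: "k \<in> A" "a k \<noteq> 0" by blast
  have "0 < (a k)\<^sup>2" using k(2) by simp
  moreover have "0 \<le> (\<Sum>i\<in>A - {k}. (a i)\<^sup>2)" by (simp add: sum_nonneg)
  ultimately have "(a k)\<^sup>2 = 1" "(\<Sum>i\<in>A - {k}. (a i)\<^sup>2) = 0"
    using assms sum.remove[OF assms(1) k(1), of "\<lambda>i. (a i)\<^sup>2"] by linarith+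
  then have "a k = 1 \<or> a k = - 1" "\<And>i. i \<in> A \<Longrightarrow> i \<noteq> k \<Longrightarrow> a i = 0"
    using assms(1) by (auto simp: power2_eq_1_iff sum_nonneg_eq_0_iff)
  then show thesis using that k(1) by blast
qed

text \<open>
  The lines through the blown-up point \<open>k\<close>: the singular members of the pencil are those through a
  second blown-up point \<open>i\<close>, and split as \<open>e\<^sub>i + (h - e\<^sub>k - e\<^sub>i)\<close>. For a line \<open>l\<close> in a
  fibre, \<open>f \<cdot> l = 0\<close> makes the coefficient of \<open>e\<^sub>k\<close> cancel against the degree in \<open>l \<cdot> l = - 1\<close>,
  so exactly one other coefficient is nonzero, and its sign decides between the two components.
\<close>

lemma singular_fibres_pencil:
  fixes k :: "'r::finite"
  shows "\<exists>L. singular_fibres (hyp - exc k :: 'r pic) L"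
proof -
  have "card (UNIV - {k}) = CARD('r) - 1" by (simp add: card_Diff_singleton)
  then obtain b where b: "bij_betw b {0..<CARD('r) - 1} (UNIV - {k})"
    using ex_bij_betw_nat_finite[of "UNIV - {k}"] by auto
  have b_range: "b i \<noteq> k" if "i < CARD('r) - 1" for i
    using bij_betwE[OF b] that by auto
  have b_inj: "b i \<noteq> b j" if "i < CARD('r) - 1" "j < CARD('r) - 1" "i \<noteq> j" for i j
    using bij_betw_imp_inj_on[OF b] that by (auto dest: inj_onD)
  have "\<exists>i < CARD('r) - 1. l = exc (b i) \<or> l = hyp - exc k - exc (b i)"
    if l: "line l" "(hyp - exc k) \<cdot> l = 0" for l :: "'r pic"
  proof -
    have dk: "snd l $ k = - fst l"
      using l(2) intersection_exc[of l k] intersection_commute[of l "exc k"]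
      by (simp add: intersection_diff_left) (simp add: hyp_def intersection_def)
    have "(\<Sum>i\<in>UNIV - {k}. (snd l $ i)\<^sup>2) = 1"
      using line_self[OF l(1)] dk
      by (simp add: intersection_self sum.remove[of UNIV k])
    then obtain j where j: "j \<in> UNIV - {k}" "snd l $ j = 1 \<or> snd l $ j = - 1"
      "\<And>i. i \<in> UNIV - {k} \<Longrightarrow> i \<noteq> j \<Longrightarrow> snd l $ i = 0"
      using sum_squares_eq_one[of "UNIV - {k}" "\<lambda>i. snd l $ i"] by (metis finite)
    have "(\<Sum>i\<in>UNIV - {k}. snd l $ i) = snd l $ j"
      using j by (subst sum.remove[of _ j]) (auto intro: sum.neutral)
    then have K: "2 * fst l + snd l $ j = 1"
      using line_canonical[OF l(1)] dk
      by (simp add: intersection_canonical sum.remove[of UNIV k])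
    have "l = exc j \<or> l = hyp - exc k - exc j"
    proof (cases "snd l $ j = 1")
      case True
      then have "fst l = 0" using K by simp
      moreover have "snd l $ i = 0" if "i \<noteq> j" for i
        using j(3)[of i] dk \<open>fst l = 0\<close> that by (cases "i = k") auto
      ultimately have "l = exc j"
        using True by (auto simp: prod_eq_iff vec_eq_iff exc_def axis_def)
      then show ?thesis ..
    next
      case False
      then have "fst l = 1" "snd l $ j = - 1" using K j(2) by auto
      then have "l = hyp - exc k - exc j"
        using j dk by (auto simp: prod_eq_iff vec_eq_iff exc_def hyp_def axis_def)
      then show ?thesis ..
    qed
    moreover obtain i where "i < CARD('r) - 1" "j = b i"
      using b j(1) unfolding bij_betw_def by (metis atLeastLessThan_iff imageE)
    ultimately show ?thesis by blast
  qed
  then have "singular_fibres (hyp - exc k) (\<lambda>i. exc (b i))"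
    using b_range b_inj
    by (auto simp: singular_fibres_def line_exc intersection_diff_left intersection_basis)
  then show ?thesis
    by (rule exI[where x = "\<lambda>i. exc (b i)"])
qed

lemma ruling_degree_one:
  fixes f :: "'r::finite pic"
  assumes "ruling f" and "fst f = 1"
  obtains k where "f = hyp - exc k"
proof -
  have "(\<Sum>i\<in>UNIV. (snd f $ i)\<^sup>2) = 1"
    using ruling_sums(1)[OF assms(1)] assms(2) by simp
  then obtain k where k: "snd f $ k = 1 \<or> snd f $ k = - 1" "\<And>i. i \<noteq> k \<Longrightarrow> snd f $ i = 0"
    using sum_squares_eq_one[of UNIV "\<lambda>i. snd f $ i"] by (metis finite UNIV_I)
  have "(\<Sum>i\<in>UNIV. snd f $ i) = snd f $ k"
    using k(2) by (subst sum.remove[of _ k]) (auto intro: sum.neutral)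
  then have "snd f $ k = - 1"
    using ruling_sums(2)[OF assms(1)] assms(2) by simp
  then have "f = hyp - exc k"
    using k(2) assms(2) by (auto simp: prod_eq_iff vec_eq_iff exc_def hyp_def axis_def)
  then show thesis by (rule that)
qed

text \<open>
  Induction on the degree. The multiplicities of \<open>f\<close> are its intersection numbers with the lines
  \<open>e\<^sub>i\<close>, hence nonnegative, so Noether's inequality applies in degree at least 2; reflecting in
  \<open>h - e\<^sub>i - e\<^sub>j - e\<^sub>k\<close> then changes the degree by \<open>d - m\<^sub>i - m\<^sub>j - m\<^sub>k < 0\<close>. The reflection
  preserves the form and the canonical class, hence lines, rulings and singular fibres.
\<close>

lemma ruling_singular_fibres:
  fixes f :: "'r::finite pic"
  assumes r: "3 \<le> CARD('r)" "CARD('r) \<le> 8" and "ruling f"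
  shows "\<exists>L. singular_fibres f L"
  using assms(3)
proof (induction "nat (fst f)" arbitrary: f rule: less_induct)
  case less
  have pos: "0 < fst f" by (rule ruling_degree_pos[OF r(2) less.prems])
  show ?case
  proof (cases "fst f = 1")
    case True
    then obtain k where "f = hyp - exc k"
      using ruling_degree_one[OF less.prems] by blast
    then show ?thesis using singular_fibres_pencil by blast
  next
    case False
    let ?m = "\<lambda>i. - snd f $ i"
    have "0 \<le> ?m i" for i
      using ruling_nef[OF r(2) less.prems line_exc] by (simp add: intersection_exc)
    moreover have "(\<Sum>i\<in>UNIV. (?m i)\<^sup>2) = (fst f)\<^sup>2" "(\<Sum>i\<in>UNIV. ?m i) = 3 * fst f - 2"
      using ruling_sums[OF less.prems] by (simp_all add: sum_negf)
    ultimately obtain i j k where ijk: "i \<noteq> j" "i \<noteq> k" "j \<noteq> k"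
      and big: "fst f < ?m i + ?m j + ?m k"
      using noether_inequality[OF r(1), of "fst f" ?m] pos False by (metis int_one_le_iff_zero_less
          order_le_less one_add_one zless_imp_add1_zle)
    define \<alpha> :: "'r pic" where "\<alpha> = hyp - exc i - exc j - exc k"
    have \<alpha>: "\<alpha> \<cdot> \<alpha> = - 2"
      using ijk by (simp add: \<alpha>_def intersection_bilinear intersection_basis
          intersection_commute[of "exc _" hyp])
    have "(hyp :: 'r pic) \<cdot> canonical = - 3" "(exc x :: 'r pic) \<cdot> canonical = - 1" for x
      using line_canonical[OF line_exc] by (simp_all add: intersection_canonical hyp_def)
    then have \<alpha>K: "\<alpha> \<cdot> canonical = 0"
      by (simp add: \<alpha>_def intersection_bilinear)
    have "fst (reflection \<alpha> f) = fst f + f \<cdot> \<alpha>"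
      by (simp add: reflection_def \<alpha>_def hyp_def exc_def)
    also have "\<dots> < fst f"
      using big by (simp add: \<alpha>_def intersection_bilinear intersection_exc)
         (simp add: intersection_def hyp_def)
    finally have "nat (fst (reflection \<alpha> f)) < nat (fst f)"
      using pos by simp
    then obtain L where "singular_fibres (reflection \<alpha> f) L"
      using less.hyps less.prems ruling_reflection[OF \<alpha> \<alpha>K] by blast
    then show ?thesis
      using singular_fibres_reflection[OF \<alpha> \<alpha>K] by blast
  qed
qed

section \<open>Faces of convex hulls and regular crosspolytopes\<close>

text \<open>
  A convex combination of points on one side of a hyperplane can lie on the hyperplane only if every
  point of positive weight does. Equivalently, the set \<open>?T\<close> of the proof, the open half-space together
  with the hull of the points on the hyperplane, is convex.
\<close>

lemma convex_hull_Int_supporting_hyperplane: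
  fixes a :: "'a::real_inner"
  assumes ge: "\<And>x. x \<in> S \<Longrightarrow> b \<le> a \<bullet> x"
  shows "convex hull S \<inter> {x. a \<bullet> x = b} = convex hull (S \<inter> {x. a \<bullet> x = b})"
proof
  let ?H = "convex hull (S \<inter> {x. a \<bullet> x = b})"
  let ?T = "{x. b \<le> a \<bullet> x \<and> (a \<bullet> x = b \<longrightarrow> x \<in> ?H)}"
  have "convex ?T"
  proof (rule convexI)
    fix x y and u v :: real
    assume x: "x \<in> ?T" and y: "y \<in> ?T" and uv: "0 \<le> u" "0 \<le> v" "u + v = 1"
    let ?z = "u *\<^sub>R x + v *\<^sub>R y"
    have "b = u * b + v * b"
      using uv(3) by (metis distrib_right mult_1)
    then have z: "a \<bullet> ?z - b = u * (a \<bullet> x - b) + v * (a \<bullet> y - b)"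
      by (simp add: inner_add_right right_diff_distrib)
    have nonneg: "0 \<le> u * (a \<bullet> x - b)" "0 \<le> v * (a \<bullet> y - b)"
      using x y uv by auto
    have "?z \<in> ?H" if "a \<bullet> ?z = b"
    proof -
      have "u * (a \<bullet> x - b) = 0" "v * (a \<bullet> y - b) = 0"
        using z nonneg that by linarith+
      then consider "u = 0" "v = 1" "y \<in> ?H" | "u = 1" "v = 0" "x \<in> ?H" | "x \<in> ?H" "y \<in> ?H"
        using x y uv(3) by auto
      then show ?thesis
      proof cases
        case 3
        then show ?thesis using uv by (intro convexD) auto
      qed auto
    qed
    then show "?z \<in> ?T"
      using z nonneg by auto
  qed
  moreover have "S \<subseteq> ?T"
    using ge by (auto intro: hull_inc)
  ultimately show "convex hull S \<inter> {x. a \<bullet> x = b} \<subseteq> ?H"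
    using hull_minimal[of S ?T convex] by auto
  show "?H \<subseteq> convex hull S \<inter> {x. a \<bullet> x = b}"
    using hull_mono[of "S \<inter> {x. a \<bullet> x = b}" S convex]
      hull_minimal[of "S \<inter> {x. a \<bullet> x = b}" "{x. a \<bullet> x = b}" convex] convex_hyperplane
    by auto
qed

text \<open>
  The point \<open>c\<close> is the midpoint of each \<open>x\<close> in \<open>P\<close> and its mirror image, so a face through \<open>c\<close>
  must contain \<open>x\<close>.
\<close>

lemma symmetric_face_subset:
  fixes c :: "'a::real_vector"
  assumes "P face_of G" and "Q face_of G" and "c \<in> Q"
    and sym: "\<And>x. x \<in> P \<Longrightarrow> c + c - x \<in> P"
  shows "P \<subseteq> Q"
proof
  fix x assume x: "x \<in> P"
  show "x \<in> Q"
  proof (cases "x = c")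
    case True
    then show ?thesis using assms(3) by simp
  next
    case False
    have "c = midpoint x (c + c - x)"
      by (simp add: midpoint_def scaleR_2[symmetric])
    moreover have "x \<noteq> c + c - x"
    proof
      assume "x = c + c - x"
      then have "2 *\<^sub>R x = 2 *\<^sub>R c" by (simp add: scaleR_2 algebra_simps)
      then show False using False by simp
    qed
    ultimately have "c \<in> open_segment x (c + c - x)"
      by (metis midpoint_in_open_segment)
    then show ?thesis
      using face_ofD[OF assms(2)] face_of_imp_subset[OF assms(1)] x sym assms(3) by blast
  qed
qed

text \<open>
  Composing the two point symmetries gives a translation of \<open>P\<close> into itself. A linear functional
  that increases along it has a maximum on \<open>P\<close>, so the translation is trivial.
\<close>

lemma symmetry_centre_unique:
  fixes c d :: "'a::euclidean_space"
  assumes "compact P" and "P \<noteq> {}"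
    and c: "\<And>x. x \<in> P \<Longrightarrow> c + c - x \<in> P" and d: "\<And>x. x \<in> P \<Longrightarrow> d + d - x \<in> P"
  shows "c = d"
proof -
  let ?t = "c + c - (d + d)"
  have "continuous_on P (\<lambda>x. ?t \<bullet> x)"
    by (intro continuous_intros)
  then obtain x where x: "x \<in> P" "\<And>y. y \<in> P \<Longrightarrow> ?t \<bullet> y \<le> ?t \<bullet> x"
    using continuous_attains_sup[OF assms(1,2)] by blast
  have "x + ?t \<in> P"
    using c[OF d[OF x(1)]] by (simp add: algebra_simps)
  then have "?t \<bullet> ?t \<le> 0"
    using x(2)[of "x + ?t"] by (simp add: inner_add_right)
  then have "?t = 0"
    by (metis inner_eq_zero_iff inner_ge_zero order_antisym)
  then have "2 *\<^sub>R c = 2 *\<^sub>R d"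
    by (simp add: scaleR_2)
  then show ?thesis by simp
qed

lemma frame_symmetric:
  assumes "crosspolytope_frame k P c v" and "x \<in> P"
  shows "c + c - x \<in> P"
proof -
  let ?X = "\<Union>i<k. {c + v i, c - v i}"
  have P: "P = convex hull ?X"
    using assms(1) by (simp add: crosspolytope_frame_def)
  have "convex {x. c + c - x \<in> P}"
    unfolding convex_alt
  proof (intro ballI allI impI, simp only: mem_Collect_eq)
    fix x y and u :: real
    assume "c + c - x \<in> P" "c + c - y \<in> P" "0 \<le> u \<and> u \<le> 1"
    then have "(1 - u) *\<^sub>R (c + c - x) + u *\<^sub>R (c + c - y) \<in> P"
      unfolding P using convex_convex_hull[of ?X] unfolding convex_alt by blast
    then show "c + c - ((1 - u) *\<^sub>R x + u *\<^sub>R y) \<in> P"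
      by (simp add: algebra_simps)
  qed
  moreover have "?X \<subseteq> {x. c + c - x \<in> P}"
    unfolding P by (auto intro!: hull_inc simp: algebra_simps)
  ultimately have "P \<subseteq> {x. c + c - x \<in> P}"
    unfolding P by (rule hull_minimal[rotated])
  then show ?thesis using assms(2) by auto
qed

lemma frame_vertex:
  assumes "crosspolytope_frame k P c v" and "i < k"
  shows "c + v i \<in> P"
  using assms by (auto simp: crosspolytope_frame_def intro!: hull_inc)

lemma frame_centre:
  assumes "crosspolytope_frame k P c v" and "0 < k"
  shows "c \<in> P"
proof -
  have "convex P" using assms(1) by (simp add: crosspolytope_frame_def)
  moreover have "c + v 0 \<in> P" "c + c - (c + v 0) \<in> P"
    using frame_vertex[OF assms] frame_symmetric[OF assms(1)] by blast+
  ultimately have "(1/2) *\<^sub>R (c + v 0) + (1/2) *\<^sub>R (c + c - (c + v 0)) \<in> P"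
    by (intro convexD) auto
  moreover have "(1/2) *\<^sub>R (c + v 0) + (1/2) *\<^sub>R (c + c - (c + v 0)) = c"
    by (simp flip: scaleR_add_right)
  ultimately show ?thesis by simp
qed

lemma frame_compact: "crosspolytope_frame k P c v \<Longrightarrow> compact P"
  by (auto simp: crosspolytope_frame_def intro!: finite_imp_compact_convex_hull)

text \<open>
  A polytope can have many frames, but all share the centre, by uniqueness of the centre of symmetry.
  This makes \<open>center\<close> well defined.
\<close>

lemma center_frame:
  fixes P :: "'r::finite pic_real set"
  assumes fr: "crosspolytope_frame k P c v" and k: "0 < k"
  shows "center k P = c + c"
  unfolding center_def
proof (rule the_equality)
  show "\<exists>x y. antipodal k P x y \<and> c + c = x + y"
  proof (intro exI conjI)
    show "antipodal k P (c + v 0) (c - v 0)"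
      unfolding antipodal_def using fr k by blast
  qed simp
next
  fix D assume "\<exists>x y. antipodal k P x y \<and> D = x + y"
  then obtain d w i where fr': "crosspolytope_frame k P d w" and D: "D = (d + w i) + (d - w i)"
    unfolding antipodal_def by blast
  have "d = c"
    using symmetry_centre_unique[OF frame_compact[OF fr], of d c] frame_centre[OF fr k]
      frame_symmetric[OF fr] frame_symmetric[OF fr'] by blast
  then show "D = c + c" using D by simp
qed

text \<open>
  The half-axes \<open>v i\<close> are linearly independent, since pairing a relation among them with \<open>v j\<close>
  isolates the coefficient of \<open>v j\<close>; this works for an indefinite form as well.
\<close>

lemma frame_aff_dim:
  fixes P :: "'r::finite pic_real set"
  assumes fr: "crosspolytope_frame k P c v" and k: "0 < k"
  shows "int k \<le> aff_dim P"
proof -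
  obtain \<rho> where \<rho>: "\<rho> > 0" and orth: "\<And>i j. i < k \<Longrightarrow> j < k \<Longrightarrow> - (v i \<cdot> v j) = (if i = j then \<rho> else 0)"
    using fr by (auto simp: crosspolytope_frame_def)
  have inj: "inj_on v {..<k}"
  proof (rule inj_onI, rule ccontr)
    fix i j assume "i \<in> {..<k}" "j \<in> {..<k}" "v i = v j" "i \<noteq> j"
    then show False using orth[of i j] orth[of i i] \<rho> by auto
  qed
  have "independent (v ` {..<k})"
  proof (rule independent_if_scalars_zero)
    show "finite (v ` {..<k})" by simp
    fix u x assume 0: "(\<Sum>x\<in>v ` {..<k}. u x *\<^sub>R x) = 0" and "x \<in> v ` {..<k}"
    then obtain j where j: "j < k" "x = v j" by auto
    have "0 = v j \<cdot> (\<Sum>i<k. u (v i) *\<^sub>R v i)"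
      using 0 by (simp add: sum.reindex[OF inj] intersection_eq_inner)
    also have "\<dots> = (\<Sum>i<k. u (v i) * (v j \<cdot> v i))"
      by (simp add: intersection_eq_inner inner_sum_right)
    also have "\<dots> = (\<Sum>i<k. if i = j then - u (v i) * \<rho> else 0)"
    proof (intro sum.cong refl)
      fix i assume "i \<in> {..<k}"
      then have "v j \<cdot> v i = (if i = j then - \<rho> else 0)"
        using orth[of j i] j(1) by (auto split: if_splits)
      then show "u (v i) * (v j \<cdot> v i) = (if i = j then - u (v i) * \<rho> else 0)"
        by simp
    qed
    also have "\<dots> = - u x * \<rho>"
      using j by simp
    finally show "u x = 0" using \<rho> by simp
  qed
  moreover have "v ` {..<k} \<subseteq> (+) (- c) ` P"
  proof (rule image_subsetI)
    fix i assume "i \<in> {..<k}"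
    then show "v i \<in> (+) (- c) ` P"
      using frame_vertex[OF fr, of i] by (intro image_eqI[of _ _ "c + v i"]) auto
  qed
  ultimately have "card (v ` {..<k}) \<le> dim ((+) (- c) ` P)"
    by (intro independent_card_le_dim)
  then show ?thesis
    using aff_dim_eq_dim[OF hull_inc[OF frame_centre[OF fr k]]] by (simp add: card_image[OF inj])
qed

section \<open>The facet cut out by a ruling\<close>

definition ruling_face :: "'r::finite pic \<Rightarrow> 'r pic_real set"
  where "ruling_face f = gosset \<inter> {x. real_class f \<cdot> x = 0}"

lemma ruling_face_face:
  fixes f :: "'r::finite pic"
  assumes "CARD('r) \<le> 8" and "ruling f"
  shows "ruling_face f face_of gosset"
    and "ruling_face f = convex hull (real_class ` {l. line l \<and> f \<cdot> l = 0})"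
proof -
  let ?a = "(fst (real_class f), - snd (real_class f))"
  let ?S = "real_class ` {l :: 'r pic. line l}"
  have ge: "0 \<le> ?a \<bullet> x" if "x \<in> ?S" for x
    using that ruling_nef[OF assms] unfolding intersection_eq_inner[symmetric]
    by (auto simp: real_class_intersection)
  then have "gosset \<subseteq> {x. 0 \<le> ?a \<bullet> x}"
    unfolding gosset_def by (intro hull_minimal) (auto simp: convex_halfspace_ge)
  then show "ruling_face f face_of gosset"
    unfolding ruling_face_def intersection_eq_inner
    by (intro face_of_Int_supporting_hyperplane_ge) (auto simp: gosset_def)
  have "?S \<inter> {x. real_class f \<cdot> x = 0} = real_class ` {l. line l \<and> f \<cdot> l = 0}"
    by (auto simp: real_class_intersection)
  then show "ruling_face f = convex hull (real_class ` {l. line l \<and> f \<cdot> l = 0})"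
    using convex_hull_Int_supporting_hyperplane[OF ge, of ?S]
    unfolding ruling_face_def intersection_eq_inner gosset_def by simp
qed

text \<open>
  The functional \<open>l \<cdot> _\<close> exposes the vertex \<open>l\<close>: among the lines it takes its minimum \<open>- 1\<close>
  only there.
\<close>

lemma line_extreme_point:
  fixes l :: "'r::finite pic"
  assumes "CARD('r) \<le> 8" and "line l"
  shows "real_class l extreme_point_of gosset"
proof -
  let ?a = "(fst (real_class l), - snd (real_class l))"
  let ?S = "real_class ` {l :: 'r pic. line l}"
  have ge: "- 1 \<le> ?a \<bullet> x" if x: "x \<in> ?S" for x
  proof -
    obtain l' where l': "line l'" "x = real_class l'" using x by auto
    have "real_of_int (- 1) \<le> real_of_int (l \<cdot> l')"
      using line_intersection_line(1)[OF assms l'(1)] by (simp only: of_int_le_iff)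
    then show ?thesis
      unfolding intersection_eq_inner[symmetric] l'(2) real_class_intersection by simp
  qed
  then have "gosset \<subseteq> {x. - 1 \<le> ?a \<bullet> x}"
    unfolding gosset_def by (intro hull_minimal) (auto simp: convex_halfspace_ge)
  then have "gosset \<inter> {x. ?a \<bullet> x = - 1} face_of gosset"
    by (intro face_of_Int_supporting_hyperplane_ge) (auto simp: gosset_def)
  moreover have "?S \<inter> {x. ?a \<bullet> x = - 1} = {real_class l}"
  proof -
    have eq: "?a \<bullet> real_class l' = - 1 \<longleftrightarrow> l = l'" if "line l'" for l'
    proof -
      have "real_of_int (l \<cdot> l') = real_of_int (- 1) \<longleftrightarrow> l = l'"
        using line_intersection_line(2)[OF assms that] by (simp only: of_int_eq_iff)
      then show ?thesis
        unfolding intersection_eq_inner[symmetric] real_class_intersection by simp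
    qed
    show ?thesis
    proof (intro equalityI subsetI)
      fix x assume "x \<in> ?S \<inter> {x. ?a \<bullet> x = - 1}"
      then obtain l' where "line l'" "x = real_class l'" "?a \<bullet> real_class l' = - 1"
        by blast
      then show "x \<in> {real_class l}" using eq[of l'] by simp
    next
      fix x assume "x \<in> {real_class l}"
      then show "x \<in> ?S \<inter> {x. ?a \<bullet> x = - 1}"
        using eq[of l] assms(2) by simp
    qed
  qed
  then have "gosset \<inter> {x. ?a \<bullet> x = - 1} = {real_class l}"
    using convex_hull_Int_supporting_hyperplane[OF ge, of ?S] by (simp add: gosset_def)
  ultimately show ?thesis
    by (simp add: face_of_singleton)
qed

text \<open>
  Since \<open>f \<cdot> f = 0\<close> and \<open>f \<cdot> L i = 0\<close>, subtracting \<open>f / 2\<close> from the lines \<open>L i\<close> does not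
  change their intersection numbers, so the half-axes inherit orthogonality from the singular fibres.
  The two components of a fibre add up to \<open>f\<close>, hence are opposite vertices.
\<close>

lemma ruling_face_frame:
  fixes f :: "'r::finite pic"
  assumes "3 \<le> CARD('r)" and "CARD('r) \<le> 8" and f: "ruling f"
  obtains v where "crosspolytope_frame (CARD('r) - 1) (ruling_face f) ((1/2) *\<^sub>R real_class f) v"
proof -
  obtain L where L: "singular_fibres f L"
    using ruling_singular_fibres[OF assms] by blast
  let ?k = "CARD('r) - 1"
  let ?c = "(1/2) *\<^sub>R real_class f"
  let ?v = "\<lambda>i. real_class (L i) - ?c"
  have line: "line (L i)" "f \<cdot> L i = 0" if "i < ?k" for i
    using L that by (auto simp: singular_fibres_def)
  have LL: "L i \<cdot> L j = (if i = j then - 1 else 0)" if "i < ?k" "j < ?k" for i j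
    using L that line_self[OF line(1)] by (auto simp: singular_fibres_def)
  have scale: "(t *\<^sub>R D) \<cdot> E = t * (D \<cdot> E)" "E \<cdot> (t *\<^sub>R D) = t * (E \<cdot> D)"
    for t and D E :: "'r pic_real"
    using intersection_commute[of "t *\<^sub>R D" E] intersection_commute[of D E]
    by (simp_all add: intersection_eq_inner)
  have orth: "- (?v i \<cdot> ?v j) = (if i = j then 1 else 0)" if "i < ?k" "j < ?k" for i j
    using LL[OF that] line(2)[OF that(1)] line(2)[OF that(2)] ruling_self[OF f]
      intersection_commute[of f "L i"]
    by (simp add: intersection_bilinear scale real_class_intersection)
  have half: "?c + ?c = real_class f"
    by (simp flip: scaleR_2)
  have "{l. line l \<and> f \<cdot> l = 0} = (\<Union>i<?k. {L i, f - L i})"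
  proof (intro equalityI subsetI)
    fix l assume "l \<in> {l. line l \<and> f \<cdot> l = 0}"
    then show "l \<in> (\<Union>i<?k. {L i, f - L i})"
      using L unfolding singular_fibres_def by blast
  next
    fix l assume "l \<in> (\<Union>i<?k. {L i, f - L i})"
    then obtain i where i: "i < ?k" "l = L i \<or> l = f - L i" by auto
    then show "l \<in> {l. line l \<and> f \<cdot> l = 0}"
      using line[OF i(1)] line_diff_iff[OF f line(1)[OF i(1)]] ruling_self[OF f]
      by (auto simp: intersection_bilinear)
  qed
  moreover have "real_class (f - L i) = ?c - ?v i" for i
    using half by (simp add: real_class_diff algebra_simps)
  ultimately have "real_class ` {l. line l \<and> f \<cdot> l = 0} = (\<Union>i<?k. {?c + ?v i, ?c - ?v i})"
    by (simp add: image_UN)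
  then have "crosspolytope_frame ?k (ruling_face f) ?c ?v"
    unfolding crosspolytope_frame_def ruling_face_face(2)[OF assms(2) f]
    using orth by (intro conjI exI[of _ 1]) auto
  then show thesis by (rule that)
qed

lemma gosset_aff_dim_le: "aff_dim (gosset :: 'r::finite pic_real set) \<le> int CARD('r)"
proof -
  let ?K = "canonical :: 'r pic_real"
  have "gosset \<subseteq> {x :: 'r pic_real. (fst ?K, - snd ?K) \<bullet> x = - 1}"
  proof
    fix x :: "'r pic_real" assume "x \<in> gosset"
    from subsetD[OF gosset_subset_hyperplane this] have "- (x \<cdot> ?K) = 1"
      by (rule CollectD)
    then have "?K \<cdot> x = - 1"
      unfolding intersection_commute[of ?K x] by linarith
    then show "x \<in> {x. (fst ?K, - snd ?K) \<bullet> x = - 1}"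
      unfolding intersection_eq_inner by (rule CollectI)
  qed
  then have "aff_dim (gosset :: 'r pic_real set) \<le> aff_dim {x. (fst ?K, - snd ?K) \<bullet> x = - 1}"
    by (rule aff_dim_subset)
  also have "\<dots> = int CARD('r)"
    by (subst aff_dim_hyperplane) (auto simp: canonical_eq zero_prod_def)
  finally show ?thesis .
qed

text \<open>
  Otherwise \<open>f\<close> would be orthogonal to all \<open>e\<^sub>i\<close>, hence a multiple of \<open>h\<close> with square zero,
  hence zero.
\<close>

lemma ruling_face_proper:
  assumes "ruling f"
  shows "ruling_face f \<noteq> gosset"
proof
  assume eq: "ruling_face f = gosset"
  have "snd f $ i = 0" for i
  proof -
    have "real_class (exc i) \<in> gosset"
      unfolding gosset_def using line_exc by (auto intro!: hull_inc)
    then have "real_class f \<cdot> real_class (exc i) = 0"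
      using eq by (auto simp: ruling_face_def)
    then have "f \<cdot> exc i = 0"
      by (simp add: real_class_intersection)
    then show ?thesis by (simp add: intersection_exc)
  qed
  then show False
    using ruling_sums[OF assms] by simp
qed

text \<open>
  The face has dimension at least \<open>r - 1\<close> as a crosspolytope, and it is a proper face of a polytope of
  dimension at most \<open>r\<close>, so both bounds are attained.
\<close>

lemma ruling_face_gosset_crosspolytope:
  fixes f :: "'r::finite pic"
  assumes "3 \<le> CARD('r)" and "CARD('r) \<le> 8" and "ruling f"
  shows "gosset_crosspolytope (ruling_face f)"
    and "center (CARD('r) - 1) (ruling_face f) = real_class f"
proof -
  obtain v where fr: "crosspolytope_frame (CARD('r) - 1) (ruling_face f) ((1/2) *\<^sub>R real_class f) v"
    by (rule ruling_face_frame[OF assms])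
  have k: "0 < CARD('r) - 1" using assms(1) by simp
  note face = ruling_face_face(1)[OF assms(2,3)]
  have "int (CARD('r) - 1) \<le> aff_dim (ruling_face f)"
    by (rule frame_aff_dim[OF fr k])
  moreover have "aff_dim (ruling_face f) < aff_dim (gosset :: 'r pic_real set)"
    using face ruling_face_proper[OF assms(3)] by (intro face_of_aff_dim_lt) (auto simp: gosset_def)
  ultimately have "aff_dim (ruling_face f) = aff_dim (gosset :: 'r pic_real set) - 1"
    using gosset_aff_dim_le[where 'r='r] k by linarith
  then show "gosset_crosspolytope (ruling_face f)"
    using face fr frame_centre[OF fr k]
    unfolding gosset_crosspolytope_def facet_of_def regular_crosspolytope_def by blast
  show "center (CARD('r) - 1) (ruling_face f) = real_class f"
    using center_frame[OF fr k] by (simp flip: scaleR_2)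
qed

lemma crosspolytope_of_eq_ruling_face:
  fixes f :: "'r::finite pic"
  assumes "3 \<le> CARD('r)" and "CARD('r) \<le> 8" and "ruling f"
  shows "crosspolytope_of f = ruling_face f"
  unfolding crosspolytope_of_def
proof (rule the_equality)
  show "gosset_crosspolytope (ruling_face f) \<and> center (CARD('r) - 1) (ruling_face f) = real_class f"
    using ruling_face_gosset_crosspolytope[OF assms] by simp
next
  fix P :: "'r pic_real set"
  assume P: "gosset_crosspolytope P \<and> center (CARD('r) - 1) P = real_class f"
  let ?c = "(1/2) *\<^sub>R real_class f"
  have k: "0 < CARD('r) - 1" using assms(1) by simp
  obtain c v where fr: "crosspolytope_frame (CARD('r) - 1) P c v"
    using P by (auto simp: gosset_crosspolytope_def regular_crosspolytope_def)
  have "c + c = real_class f"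
    using center_frame[OF fr k] P by simp
  then have c: "c = ?c"
    by (simp flip: \<open>c + c = real_class f\<close> scaleR_2)
  obtain w where fr': "crosspolytope_frame (CARD('r) - 1) (ruling_face f) ?c w"
    by (rule ruling_face_frame[OF assms])
  have faces: "P face_of gosset" "ruling_face f face_of gosset"
    using P ruling_face_face(1)[OF assms(2,3)] by (auto simp: gosset_crosspolytope_def facet_of_def)
  show "P = ruling_face f"
  proof (rule equalityI)
    show "P \<subseteq> ruling_face f"
      using symmetric_face_subset[OF faces frame_centre[OF fr' k]] frame_symmetric[OF fr] c by blast
    show "ruling_face f \<subseteq> P"
      using symmetric_face_subset[OF faces(2,1)] frame_centre[OF fr k] frame_symmetric[OF fr'] c
      by blast
  qed
qed

theorem lemma15:
  fixes f l :: "'r::finite pic"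
  assumes "3 \<le> CARD('r)" and "CARD('r) \<le> 8"
    and "ruling f" and "line l"
  shows "(f \<cdot> l = 0 \<longleftrightarrow> line (f - l)) \<and>
    (line (f - l) \<longleftrightarrow> real_class l extreme_point_of crosspolytope_of f)"
proof -
  have "real_class l extreme_point_of crosspolytope_of f \<longleftrightarrow> real_class l \<in> ruling_face f"
    unfolding crosspolytope_of_eq_ruling_face[OF assms(1-3)]
    using extreme_point_of_face[OF ruling_face_face(1)[OF assms(2,3)]]
      line_extreme_point[OF assms(2,4)] by blast
  also have "\<dots> \<longleftrightarrow> f \<cdot> l = 0"
  proof -
    have "real_class l \<in> gosset"
      using line_extreme_point[OF assms(2,4)] by (simp add: extreme_point_of_def)
    then show ?thesis
      by (simp add: ruling_face_def real_class_intersection)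
  qed
  finally show ?thesis
    using line_diff_iff[OF assms(3,4)] by blast
qed

end
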